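(* For every integer $k\ge 8$, there is a function $f:\mathbb F_2^{k+4}\to\mathbb F_2^k$ such that $$I(f(X);Y)>k\,C(p)$$ for all $p<1/2$ sufficiently close to $1/2$ (that is, there is $\varepsilon>0$ such that the inequality holds for all $p\in(1/2-\varepsilon,1/2)$). Here $X$ is uniform on $\mathbb F_2^{k+4}$, $Y=X\oplus Z$ with $Z$ independent of $X$ having i.i.d. Bernoulli$(p)$ coordinates, and $C(p)=1-h_2(p)$.
   Context: Entropies and mutual informations are measured in bits (logarithms base 2). $h_2(p)=-p\log_2 p-(1-p)\log_2(1-p)$ is the binary entropy function, with $0\log_2 0=0$. $\oplus$ is coordinatewise addition in $\mathbb F_2$. *)

theory Defs
  imports "HOL-Probability.Probability" "HOL-Library.Z2"
begin

definition F2_vec :: "nat \<Rightarrow> bit list set" where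
  "F2_vec n = {x. length x = n}"

definition vec_add :: "bit list \<Rightarrow> bit list \<Rightarrow> bit list" where
  "vec_add x z = map2 (+) x z"

(* Joint law of (X, Z): the product of the uniform law on F2_vec n and of n i.i.d.
   Bernoulli(p) bits. For p outside [0,1], bernoulli_pmf truncates p to that interval. *)
definition input_noise :: "nat \<Rightarrow> real \<Rightarrow> (bit list \<times> bit list) pmf" where
  "input_noise n p =
     pair_pmf (pmf_of_set (F2_vec n)) (replicate_pmf n (map_pmf of_bool (bernoulli_pmf p)))"

(* I(f(X); Y) in bits on the sample space of pairs (x, z), with Y = X + Z. The type bit list
   is countable, so count_space UNIV is a legitimate (sigma-finite, discrete) value space
   for both random variables; lists of the wrong length have probability zero. *)
definition MI_bsc :: "nat \<Rightarrow> real \<Rightarrow> (bit list \<Rightarrow> bit list) \<Rightarrow> real" where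
  "MI_bsc n p f =
     prob_space.mutual_information (measure_pmf (input_noise n p)) 2
       (count_space UNIV) (count_space UNIV)
       (\<lambda>(x, z). f x) (\<lambda>(x, z). vec_add x z)"

(* At p = 0 and p = 1 the products vanish, which is the convention 0 log 0 = 0. *)
definition h2 :: "real \<Rightarrow> real" where
  "h2 p = - p * log 2 p - (1 - p) * log 2 (1 - p)"

definition bsc_capacity :: "real \<Rightarrow> real" where
  "bsc_capacity p = 1 - h2 p"

end

theory Submission
  imports Defs "HOL-Real_Asymp.Real_Asymp"
begin

text \<open>
  Put \<open>d = 1 - 2 * p\<close>. To second order in \<open>d\<close>, the mutual information depends on \<open>f\<close> only through
  the mean squared norm \<open>M\<close> of the centroids of the fibres of \<open>f\<close>, taken in the \<open>+1/-1\<close> cube: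
  it is at least \<open>M * d\<^sup>2 / (2 * ln 2) - O(d\<^sup>3)\<close>, while the capacity is \<open>d\<^sup>2 / (2 * ln 2) + o(d\<^sup>2)\<close>.
  So it suffices to have \<open>M > k\<close>. Fibres that are the translates of a set of 16 coset leaders of
  a suitable [12,8] code, extended by uncoded coordinates, give \<open>M = k + 1 / 16\<close>.
\<close>

declare add_bit_eq_xor [simp del]

section \<open>Characters on binary vectors\<close>

definition chi :: "bit \<Rightarrow> real" where
  "chi a = (if a = 0 then 1 else -1)"

lemma chi_simps [simp]: "chi 0 = 1" "chi 1 = -1"
  by (simp_all add: chi_def)

lemma chi_square [simp]: "chi a * chi a = 1"
  by (simp add: chi_def)

lemma chi_add: "chi (a + b) = chi a * chi b"
  by (cases a; cases b) simp_all

lemma abs_chi [simp]: "\<bar>chi a\<bar> = 1"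
  by (simp add: chi_def)

lemma UNIV_bit: "UNIV = {0::bit, 1}"
  by auto

lemma finite_UNIV_bit [simp]: "finite (UNIV :: bit set)"
  by (simp add: UNIV_bit)

lemma countable_UNIV_bit_list: "countable (UNIV :: bit list set)"
proof -
  have "countable (lists (UNIV :: bit set))"
    by (intro countable_lists countable_finite) simp
  then show ?thesis by simp
qed

lemma F2_vec_0: "F2_vec 0 = {[]}"
  by (auto simp: F2_vec_def)

lemma F2_vec_Suc: "F2_vec (Suc n) = (\<lambda>(a, x). a # x) ` (UNIV \<times> F2_vec n)"
  by (auto simp: F2_vec_def length_Suc_conv image_iff)

lemma finite_F2_vec [simp]: "finite (F2_vec n)"
  by (induction n) (simp_all add: F2_vec_0 F2_vec_Suc)

text \<open>Product structure of the cube: the character sums below are evaluated by writing each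
  summand as a product over coordinates. \<open>g\<close> is generalised in the induction because
  peeling off the first bit shifts the index.\<close>

lemma sum_prod_F2_vec:
  fixes g :: "nat \<Rightarrow> bit \<Rightarrow> real"
  shows "(\<Sum>x\<in>F2_vec n. \<Prod>i<n. g i (x ! i)) = (\<Prod>i<n. g i 0 + g i 1)"
proof (induction n arbitrary: g)
  case 0
  then show ?case by (simp add: F2_vec_0)
next
  case (Suc n)
  have "(\<Sum>x\<in>F2_vec (Suc n). \<Prod>i<Suc n. g i (x ! i)) =
      (\<Sum>(a, x)\<in>UNIV \<times> F2_vec n. \<Prod>i<Suc n. g i ((a # x) ! i))"
    unfolding F2_vec_Suc by (subst sum.reindex) (auto simp: inj_on_def split_def)
  also have "\<dots> = (\<Sum>a\<in>UNIV. \<Sum>x\<in>F2_vec n. g 0 a * (\<Prod>i<n. g (Suc i) (x ! i)))"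
    by (simp add: sum.cartesian_product prod.lessThan_Suc_shift split_def del: prod.lessThan_Suc)
  also have "\<dots> = (g 0 0 + g 0 1) * (\<Prod>i<n. g (Suc i) 0 + g (Suc i) 1)"
    by (simp add: UNIV_bit sum_distrib_left[symmetric] Suc.IH[of "\<lambda>i. g (Suc i)"] distrib_right)
  finally show ?case by (simp add: prod.lessThan_Suc_shift del: prod.lessThan_Suc)
qed

lemma card_F2_vec: "card (F2_vec n) = 2 ^ n"
proof -
  have "real (card (F2_vec n)) = real (2 ^ n)"
    using sum_prod_F2_vec[where g = "\<lambda>_ _. 1" and n = n] by simp
  then show ?thesis
    by (simp only: of_nat_eq_iff)
qed

text \<open>Isolates coordinate \<open>i\<close>, so that a factor \<open>chi (y ! i)\<close> can be
  absorbed into a coordinatewise product or extracted from it.\<close>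

lemma prod_if_eq:
  fixes i n :: nat and f g :: "nat \<Rightarrow> real"
  assumes "i < n"
  shows "(\<Prod>j<n. if j = i then f j else g j) = f i * (\<Prod>j\<in>{..<n} - {i}. g j)"
  using assms by (subst prod.remove[of _ i]) (auto intro!: prod.cong)

lemma prod_const_but_one:
  fixes i n :: nat and c a :: real
  assumes "i < n"
  shows "(\<Prod>j<n. if j = i then c * a else c) = c ^ n * a"
proof -
  have "c * c ^ (n - Suc 0) = c ^ n"
    using assms by (cases n) auto
  then show ?thesis
    using assms by (simp add: prod_if_eq[OF assms] mult.commute mult.left_commute)
qed

lemma sum_chi:
  assumes "i < n"
  shows "(\<Sum>y\<in>F2_vec n. chi (y ! i)) = 0"
proof -
  have "(\<Sum>y\<in>F2_vec n. chi (y ! i)) =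
      (\<Sum>y\<in>F2_vec n. \<Prod>j<n. if j = i then chi (y ! j) else 1)"
    using assms by (simp add: prod_if_eq)
  \<comment> \<open>Coordinate \<open>i\<close> contributes \<open>chi 0 + chi 1 = 0\<close>, every
    other one \<open>1 + 1 = 2\<close>.\<close>
  also have "\<dots> = (\<Prod>j<n. if j = i then 2 * 0 else 2)"
    by (subst sum_prod_F2_vec[where g = "\<lambda>j c. if j = i then chi c else 1"]) (rule prod.cong, auto)
  finally show ?thesis
    using assms by (simp add: prod_if_eq)
qed

text \<open>Orthogonality of the coordinate characters: for distinct indices the factor at
  \<open>i\<close> alone already sums to zero.\<close>

lemma sum_chi_chi:
  assumes "i < n" "j < n"
  shows "(\<Sum>y\<in>F2_vec n. chi (y ! i) * chi (y ! j)) = (if i = j then 2 ^ n else 0)"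
proof (cases "i = j")
  case True
  then show ?thesis by (simp add: card_F2_vec)
next
  case False
  have "(\<Sum>y\<in>F2_vec n. chi (y ! i) * chi (y ! j)) =
      (\<Sum>y\<in>F2_vec n. \<Prod>l<n. if l = i then chi (y ! l) else if l = j then chi (y ! l) else 1)"
    using assms False by (subst prod_if_eq) (auto intro!: sum.cong simp: prod.If_cases)
  also have "\<dots> = (\<Prod>l<n. if l = i then 0 else if l = j then 0 else 2)"
    by (subst sum_prod_F2_vec[where g = "\<lambda>l c. if l = i then chi c else if l = j then chi c else 1"])
      (rule prod.cong, auto)
  also have "\<dots> = 0"
    using assms by (simp add: prod_if_eq)
  finally show ?thesis using False by simp
qed

section \<open>Tilted densities\<close>

text \<open>With \<open>d = 1 - 2 * p\<close>, this is \<open>2 ^ n\<close> times the transition probability of the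
  channel from \<open>x\<close> to \<open>y\<close>.\<close>

definition tilt :: "real \<Rightarrow> bit list \<Rightarrow> bit list \<Rightarrow> real" where
  "tilt d x y = (\<Prod>i<length x. 1 + d * chi (x ! i) * chi (y ! i))"

lemma sum_tilt:
  assumes "x \<in> F2_vec n"
  shows "(\<Sum>y\<in>F2_vec n. tilt d x y) = 2 ^ n"
  using assms sum_prod_F2_vec[where g = "\<lambda>i c. 1 + d * chi (x ! i) * chi c" and n = n]
  by (simp add: tilt_def F2_vec_def)

lemma sum_tilt_chi:
  assumes "x \<in> F2_vec n" "i < n"
  shows "(\<Sum>y\<in>F2_vec n. tilt d x y * chi (y ! i)) = 2 ^ n * (d * chi (x ! i))"
proof -
  let ?g = "\<lambda>j c. if j = i then (1 + d * chi (x ! j) * chi c) * chi c else 1 + d * chi (x ! j) * chi c"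
  have "(\<Sum>y\<in>F2_vec n. tilt d x y * chi (y ! i)) = (\<Sum>y\<in>F2_vec n. \<Prod>j<n. ?g j (y ! j))"
    using assms by (subst prod_if_eq)
      (auto simp: tilt_def F2_vec_def prod.remove[of _ i] mult_ac)
  \<comment> \<open>As \<open>chi\<close> squares to 1, multiplying by \<open>chi c\<close> swaps
    the constant and linear parts of the factor at \<open>i\<close>; only the former linear part
    survives summation over \<open>c\<close>.\<close>
  also have "\<dots> = (\<Prod>j<n. if j = i then 2 * (d * chi (x ! i)) else 2)"
    by (subst sum_prod_F2_vec[where g = ?g]) (rule prod.cong, auto)
  also have "\<dots> = 2 ^ n * (d * chi (x ! i))"
    using assms(2) by (rule prod_const_but_one)
  finally show ?thesis .
qed

lemma tilt_factor_bounds: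
  assumes "0 \<le> d" "d < 1"
  shows "1 + d * chi a * chi b > 0" "\<bar>1 + d * chi a * chi b\<bar> \<le> 2"
  using assms by (auto simp: chi_def)

lemma tilt_pos:
  assumes "0 \<le> d" "d < 1"
  shows "tilt d x y > 0"
  using assms unfolding tilt_def by (intro prod_pos ballI tilt_factor_bounds)

text \<open>Telescoping: each factor is at distance \<open>d\<close> from 1 and at most 2 in
  absolute value. The bound is crude in the length, but only its linear order in \<open>d\<close>
  matters.\<close>

lemma abs_tilt_minus_one_le:
  assumes "0 \<le> d" "d < 1"
  shows "\<bar>tilt d x y - 1\<bar> \<le> 2 ^ length x * d"
proof -
  \<comment> \<open>The sharper constant closes the induction:
    \<open>2 * (2 ^ n - 1) + 1 = 2 ^ Suc n - 1\<close>.\<close>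
  have "\<bar>(\<Prod>i<n. 1 + d * chi (x ! i) * chi (y ! i)) - 1\<bar> \<le> (2 ^ n - 1) * d" for n
  proof (induction n)
    case (Suc n)
    let ?P = "\<Prod>i<n. 1 + d * chi (x ! i) * chi (y ! i)"
    let ?a = "1 + d * chi (x ! n) * chi (y ! n)"
    have "\<bar>?P * ?a - 1\<bar> = \<bar>(?P - 1) * ?a + (?a - 1)\<bar>"
      by (simp add: algebra_simps)
    also have "\<dots> \<le> \<bar>?P - 1\<bar> * \<bar>?a\<bar> + \<bar>?a - 1\<bar>"
      unfolding abs_mult[symmetric] by (rule abs_triangle_ineq)
    also have "\<dots> \<le> ((2 ^ n - 1) * d) * 2 + d"
      using Suc tilt_factor_bounds(2)[OF assms] assms
      by (intro add_mono mult_mono) (auto simp: abs_mult)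
    finally show ?case by (simp add: algebra_simps)
  qed simp
  from this[of "length x"] assms show ?thesis
    by (simp add: tilt_def algebra_simps)
qed

section \<open>Polynomial bounds for the logarithm\<close>

lemma ln_ge_quadratic:
  fixes t :: real
  assumes "t \<ge> 0"
  shows "ln (1 + t) \<ge> t - t\<^sup>2 / 2"
proof -
  have "(\<lambda>t. ln (1 + t) - (t - t\<^sup>2 / 2)) 0 \<le> (\<lambda>t. ln (1 + t) - (t - t\<^sup>2 / 2)) t"
  proof (rule DERIV_nonneg_imp_nondecreasing[OF assms])
    fix s :: real assume s: "0 \<le> s"
    have "((\<lambda>t. ln (1 + t) - (t - t\<^sup>2 / 2)) has_real_derivative 1 / (1 + s) - (1 - s)) (at s)"
      using s by (auto intro!: derivative_eq_intros)
    moreover have "1 / (1 + s) - (1 - s) = s\<^sup>2 / (1 + s)"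
      using s by (simp add: field_simps power2_eq_square)
    ultimately show "\<exists>y. ((\<lambda>t. ln (1 + t) - (t - t\<^sup>2 / 2)) has_real_derivative y) (at s) \<and> 0 \<le> y"
      using s by (metis divide_nonneg_nonneg add_nonneg_nonneg zero_le_one zero_le_power2)
  qed
  then show ?thesis by simp
qed

lemma ln_le_quadratic:
  fixes t :: real
  assumes "-1 < t" "t \<le> 0"
  shows "ln (1 + t) \<le> t - t\<^sup>2 / 2"
proof -
  have "(\<lambda>t. ln (1 + t) - (t - t\<^sup>2 / 2)) t \<le> (\<lambda>t. ln (1 + t) - (t - t\<^sup>2 / 2)) 0"
  proof (rule DERIV_nonneg_imp_nondecreasing[OF assms(2)])
    fix s :: real assume s: "t \<le> s"
    have "((\<lambda>t. ln (1 + t) - (t - t\<^sup>2 / 2)) has_real_derivative 1 / (1 + s) - (1 - s)) (at s)"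
      using s assms by (auto intro!: derivative_eq_intros)
    moreover have "1 / (1 + s) - (1 - s) = s\<^sup>2 / (1 + s)"
      using s assms by (simp add: field_simps power2_eq_square)
    moreover have "0 \<le> s\<^sup>2 / (1 + s)"
      using s assms by (intro divide_nonneg_nonneg) auto
    ultimately show "\<exists>y. ((\<lambda>t. ln (1 + t) - (t - t\<^sup>2 / 2)) has_real_derivative y) (at s) \<and> 0 \<le> y"
      by metis
  qed
  then show ?thesis by simp
qed

text \<open>The right-hand side is the third-order Taylor polynomial of \<open>q * ln q\<close> at
  1. The difference vanishes at 1, and the two quadratic bounds make it nonincreasing up to 1 and
  nondecreasing from there.\<close>

lemma mult_ln_ge_cubic:
  fixes q :: real
  assumes "q > 0"
  shows "q * ln q \<ge> (q - 1) + (q - 1)\<^sup>2 / 2 - (q - 1) ^ 3 / 6"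
proof -
  define g where "g = (\<lambda>q::real. q * ln q - ((q - 1) + (q - 1)\<^sup>2 / 2 - (q - 1) ^ 3 / 6))"
  define g' where "g' = (\<lambda>q::real. ln q - ((q - 1) - (q - 1)\<^sup>2 / 2))"
  have deriv: "(g has_real_derivative g' s) (at s)" if "s > 0" for s
    unfolding g_def g'_def using that
    by (auto intro!: derivative_eq_intros simp: field_simps)
  have "g 1 \<le> g q"
  proof (cases "q \<ge> 1")
    case True
    then show ?thesis
    proof (rule DERIV_nonneg_imp_nondecreasing)
      fix s :: real assume "1 \<le> s"
      then show "\<exists>y. (g has_real_derivative y) (at s) \<and> 0 \<le> y"
        using deriv[of s] ln_ge_quadratic[of "s - 1"] by (auto simp: g'_def)
    qed
  next
    case False
    then have "q \<le> 1" by simp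
    then show ?thesis
    proof (rule DERIV_nonpos_imp_nonincreasing)
      fix s :: real assume "q \<le> s" "s \<le> 1"
      then show "\<exists>y. (g has_real_derivative y) (at s) \<and> y \<le> 0"
        using assms deriv[of s] ln_le_quadratic[of "s - 1"] by (auto simp: g'_def)
    qed
  qed
  then show ?thesis by (simp add: g_def)
qed

text \<open>With \<open>d = 1 - 2 * p\<close>, this is the density, relative to the uniform law, of
  the channel output for an input uniform on \<open>F\<close>.\<close>

definition fibre_density :: "real \<Rightarrow> bit list set \<Rightarrow> bit list \<Rightarrow> real" where
  "fibre_density d F y = (\<Sum>x\<in>F. tilt d x y) / card F"

definition centroid :: "bit list set \<Rightarrow> nat \<Rightarrow> real" where
  "centroid F i = (\<Sum>x\<in>F. chi (x ! i)) / card F"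

text \<open>The quadratic term is Bessel's inequality: \<open>q - 1\<close> has normalised inner product
  \<open>d * centroid F i\<close> with the \<open>i\<close>-th coordinate character.\<close>

lemma fibre_divergence_ge:
  fixes n :: nat and d :: real
  assumes F: "F \<subseteq> F2_vec n" "F \<noteq> {}" and d: "0 \<le> d" "d < 1"
  defines "q \<equiv> fibre_density d F"
  shows "(\<Sum>y\<in>F2_vec n. q y * ln (q y)) \<ge>
    2 ^ n * (d\<^sup>2 / 2 * (\<Sum>i<n. (centroid F i)\<^sup>2) - (2 ^ n * d) ^ 3 / 6)"
proof -
  define \<mu> where "\<mu> = centroid F"
  \<comment> \<open>\<open>d * l\<close> is the orthogonal projection of \<open>q - 1\<close> onto
    the span of the coordinate characters.\<close>
  define l where "l = (\<lambda>y. \<Sum>i<n. \<mu> i * chi (y ! i))"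
  define M where "M = (\<Sum>i<n. (\<mu> i)\<^sup>2)"
  define N where "N = (2 ^ n :: real)"
  have fin: "finite F" using F(1) finite_F2_vec by (rule finite_subset)
  have c: "card F > 0" using fin F(2) by (simp add: card_gt_0_iff)
  have q_pos: "q y > 0" for y
    unfolding q_def fibre_density_def using c F(2) fin d
    by (intro divide_pos_pos sum_pos tilt_pos) auto
  have q_bound: "\<bar>q y - 1\<bar> \<le> N * d" for y
  proof -
    have "q y - 1 = (\<Sum>x\<in>F. tilt d x y - 1) / card F"
      using c by (simp add: q_def fibre_density_def sum_subtractf diff_divide_distrib)
    also have "\<bar>\<dots>\<bar> \<le> (\<Sum>x\<in>F. \<bar>tilt d x y - 1\<bar>) / card F"
      by (simp add: divide_right_mono)
    also have "\<dots> \<le> (\<Sum>x\<in>F. N * d) / card F"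
    proof (intro divide_right_mono sum_mono)
      fix x assume "x \<in> F"
      then have "length x = n" using F(1) by (auto simp: F2_vec_def)
      then show "\<bar>tilt d x y - 1\<bar> \<le> N * d"
        using abs_tilt_minus_one_le[OF d, of x y] by (simp add: N_def)
    qed simp
    also have "\<dots> = N * d" using c by simp
    finally show ?thesis .
  qed
  have sum_q: "(\<Sum>y\<in>F2_vec n. q y) = N"
  proof -
    have "(\<Sum>y\<in>F2_vec n. q y) = (\<Sum>x\<in>F. \<Sum>y\<in>F2_vec n. tilt d x y) / card F"
      unfolding q_def fibre_density_def sum_divide_distrib[symmetric]
      by (subst sum.swap) simp
    also have "\<dots> = (\<Sum>x\<in>F. N) / card F"
      using F(1) by (intro arg_cong2[of _ _ _ _ "(/)"] sum.cong) (auto simp: sum_tilt N_def)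
    finally show ?thesis using c by simp
  qed
  have sum_q_chi: "(\<Sum>y\<in>F2_vec n. q y * chi (y ! i)) = N * (d * \<mu> i)" if "i < n" for i
  proof -
    have "(\<Sum>y\<in>F2_vec n. q y * chi (y ! i)) =
        (\<Sum>x\<in>F. \<Sum>y\<in>F2_vec n. tilt d x y * chi (y ! i)) / card F"
      unfolding q_def fibre_density_def
      by (subst sum.swap) (simp add: sum_distrib_right sum_divide_distrib)
    also have "\<dots> = (\<Sum>x\<in>F. N * (d * chi (x ! i))) / card F"
      using F(1) that by (intro arg_cong2[of _ _ _ _ "(/)"] sum.cong) (auto simp: sum_tilt_chi N_def)
    also have "\<dots> = N * (d * \<mu> i)"
      by (simp add: \<mu>_def centroid_def sum_distrib_left[symmetric])
    finally show ?thesis .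
  qed
  have sum_tl: "(\<Sum>y\<in>F2_vec n. (q y - 1) * l y) = N * d * M"
  proof -
    have "(\<Sum>y\<in>F2_vec n. (q y - 1) * l y) =
        (\<Sum>i<n. \<mu> i * (\<Sum>y\<in>F2_vec n. q y * chi (y ! i) - chi (y ! i)))"
      unfolding l_def sum_distrib_left by (subst sum.swap) (simp add: algebra_simps)
    also have "\<dots> = (\<Sum>i<n. N * d * (\<mu> i)\<^sup>2)"
      by (intro sum.cong) (simp_all add: sum_subtractf sum_q_chi sum_chi power2_eq_square)
    finally show ?thesis by (simp add: M_def sum_distrib_left)
  qed
  have sum_ll: "(\<Sum>y\<in>F2_vec n. (l y)\<^sup>2) = N * M"
  proof -
    have "(\<Sum>y\<in>F2_vec n. (l y)\<^sup>2) =
        (\<Sum>y\<in>F2_vec n. \<Sum>i<n. \<Sum>j<n. \<mu> i * \<mu> j * (chi (y ! i) * chi (y ! j)))"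
      unfolding l_def power2_eq_square sum_product by (simp add: mult_ac)
    also have "\<dots> = (\<Sum>i<n. \<Sum>y\<in>F2_vec n. \<Sum>j<n. \<mu> i * \<mu> j * (chi (y ! i) * chi (y ! j)))"
      by (rule sum.swap)
    also have "\<dots> = (\<Sum>i<n. \<Sum>j<n. \<Sum>y\<in>F2_vec n. \<mu> i * \<mu> j * (chi (y ! i) * chi (y ! j)))"
      by (intro sum.cong refl sum.swap)
    also have "\<dots> = (\<Sum>i<n. \<Sum>j<n. \<mu> i * \<mu> j * (if i = j then N else 0))"
      by (intro sum.cong refl) (simp add: sum_distrib_left[symmetric] sum_chi_chi N_def)
    also have "\<dots> = (\<Sum>i<n. N * (\<mu> i)\<^sup>2)"
      by (simp add: if_distrib power2_eq_square mult_ac cong: if_cong)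
    finally show ?thesis by (simp add: M_def sum_distrib_left)
  qed
  have pointwise: "q y * ln (q y) \<ge>
      (q y - 1) + (2 * d * ((q y - 1) * l y) - d\<^sup>2 * (l y)\<^sup>2) / 2 - (N * d) ^ 3 / 6" for y
  proof -
    \<comment> \<open>Bessel's inequality in pointwise form, from the square of
      \<open>(q y - 1) - d * l y\<close>.\<close>
    have sq: "2 * d * ((q y - 1) * l y) - d\<^sup>2 * (l y)\<^sup>2 \<le> (q y - 1)\<^sup>2"
      using zero_le_power2[of "(q y - 1) - d * l y"] by (simp add: power2_eq_square algebra_simps)
    \<comment> \<open>Odd powers are monotone on the whole real line, so the upper bound on
      \<open>q y - 1\<close> suffices whatever its sign.\<close>
    have cube: "(q y - 1) ^ 3 \<le> (N * d) ^ 3"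
      using q_bound[of y] by (intro power_mono_odd) auto
    have "(q y - 1) + (2 * d * ((q y - 1) * l y) - d\<^sup>2 * (l y)\<^sup>2) / 2 - (N * d) ^ 3 / 6 \<le>
        (q y - 1) + (q y - 1)\<^sup>2 / 2 - (q y - 1) ^ 3 / 6"
      by (intro add_mono diff_mono divide_right_mono order_refl sq cube) simp_all
    also have "\<dots> \<le> q y * ln (q y)"
      by (rule mult_ln_ge_cubic[OF q_pos])
    finally show ?thesis .
  qed
  have "(\<Sum>y\<in>F2_vec n. q y * ln (q y)) \<ge> (\<Sum>y\<in>F2_vec n.
      (q y - 1) + (2 * d * ((q y - 1) * l y) - d\<^sup>2 * (l y)\<^sup>2) / 2 - (N * d) ^ 3 / 6)"
    by (intro sum_mono pointwise)
  \<comment> \<open>The first-order part sums to zero because \<open>q\<close> and the constant 1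
    have the same total \<open>N\<close>; the cross term is twice the square term that is
    subtracted.\<close>
  also have "(\<Sum>y\<in>F2_vec n.
      (q y - 1) + (2 * d * ((q y - 1) * l y) - d\<^sup>2 * (l y)\<^sup>2) / 2 - (N * d) ^ 3 / 6) =
      (2 * d * (N * d * M) - d\<^sup>2 * (N * M)) / 2 - N * ((N * d) ^ 3 / 6)"
    by (simp add: sum.distrib sum_subtractf sum_divide_distrib[symmetric]
        sum_distrib_left[symmetric] sum_q sum_tl sum_ll card_F2_vec N_def)
  also have "\<dots> = N * (d\<^sup>2 / 2 * M - (N * d) ^ 3 / 6)"
    by (simp add: power2_eq_square algebra_simps)
  finally show ?thesis by (simp add: M_def N_def \<mu>_def)
qed

section \<open>Mutual information\<close>

lemma distributed_pmf:
  "distributed (measure_pmf D) (count_space UNIV) X (\<lambda>x. ennreal (pmf (map_pmf X D) x))"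
  by (simp add: distributed_def map_pmf_rep_eq[symmetric] measure_pmf_eq_density[symmetric])

text \<open>Countability makes the product of the counting spaces a counting space, and the integral
  over it is a finite sum because the integrand vanishes where the joint mass does.\<close>

lemma mutual_information_pmf:
  fixes X :: "'a \<Rightarrow> 'b" and Y :: "'a \<Rightarrow> 'c"
  assumes "1 < b" and c: "countable (UNIV :: 'b set)" "countable (UNIV :: 'c set)"
    and S: "finite S" "set_pmf (map_pmf (\<lambda>\<omega>. (X \<omega>, Y \<omega>)) D) \<subseteq> S"
  shows "prob_space.mutual_information (measure_pmf D) b (count_space UNIV) (count_space UNIV) X Y =
    (\<Sum>(x, y)\<in>S. pmf (map_pmf (\<lambda>\<omega>. (X \<omega>, Y \<omega>)) D) (x, y) *
      log b (pmf (map_pmf (\<lambda>\<omega>. (X \<omega>, Y \<omega>)) D) (x, y) /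
        (pmf (map_pmf X D) x * pmf (map_pmf Y D) y)))"
proof -
  interpret information_space "measure_pmf D" b
    by standard (fact \<open>1 < b\<close>)
  let ?J = "pmf (map_pmf (\<lambda>\<omega>. (X \<omega>, Y \<omega>)) D)"
  let ?f = "\<lambda>z. ?J z * log b (?J z / (pmf (map_pmf X D) (fst z) * pmf (map_pmf Y D) (snd z)))"
  have pair: "count_space UNIV \<Otimes>\<^sub>M count_space UNIV = (count_space UNIV :: ('b \<times> 'c) measure)"
    using pair_measure_countable[OF c] by simp
  have "prob_space.mutual_information (measure_pmf D) b (count_space UNIV) (count_space UNIV) X Y =
      integral\<^sup>L (count_space UNIV \<Otimes>\<^sub>M count_space UNIV) ?f"
    by (rule mutual_information_distr[where Px = "pmf (map_pmf X D)" and Py = "pmf (map_pmf Y D)"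
          and Pxy = ?J])
      (auto simp: pair intro: distributed_pmf sigma_finite_measure_count_space_countable c)
  also have "\<dots> = (\<Sum>z | z \<in> UNIV \<and> ?f z \<noteq> 0. ?f z)"
    unfolding pair using S
    by (intro lebesgue_integral_count_space_finite_support)
      (auto intro!: finite_subset[OF _ S(1)] simp: set_pmf_eq)
  also have "\<dots> = (\<Sum>z\<in>S. ?f z)"
    using S by (intro sum.mono_neutral_left) (auto simp: set_pmf_eq)
  finally show ?thesis by (simp add: split_def)
qed

section \<open>Law of the noise and of the channel output\<close>

lemma pmf_replicate_bernoulli:
  assumes "0 \<le> p" "p \<le> 1"
  shows "pmf (replicate_pmf (length z) (map_pmf of_bool (bernoulli_pmf p))) z =
    (\<Prod>i<length z. (1 + (1 - 2 * p) * chi (z ! i)) / 2)"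
proof (induction z)
  case (Cons a z)
  let ?B = "map_pmf of_bool (bernoulli_pmf p) :: bit pmf"
  have "pmf (replicate_pmf (Suc (length z)) ?B) (a # z) =
      pmf (map_pmf (\<lambda>(x, xs). x # xs) (pair_pmf ?B (replicate_pmf (length z) ?B))) (a # z)"
    \<comment> \<open>Seen as an injective image of a pair, the word law splits into head and
      tail.\<close>
    by (simp add: pair_pmf_def map_bind_pmf)
  also have "\<dots> = pmf ?B a * pmf (replicate_pmf (length z) ?B) z"
    using pmf_map_inj'[of "\<lambda>(x, xs). x # xs" _ "(a, z)"]
    by (simp add: inj_on_def pmf_pair)
  \<comment> \<open>This is \<open>1 - p\<close> for bit 0 and \<open>p\<close> for bit 1.\<close>
  also have "pmf ?B a = (1 + (1 - 2 * p) * chi a) / 2"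
  proof -
    have *: "pmf ?B (of_bool c) = pmf (bernoulli_pmf p) c" for c
      by (rule pmf_map_inj') (auto simp: inj_on_def)
    show ?thesis
      using *[of True] *[of False] assms by (cases a) (auto simp: field_simps)
  qed
  finally show ?case
    using Cons by (simp add: prod.lessThan_Suc_shift del: prod.lessThan_Suc replicate_pmf.simps)
qed simp

lemma vec_add_nth:
  "length x = length y \<Longrightarrow> i < length x \<Longrightarrow> vec_add x y ! i = x ! i + y ! i"
  by (simp add: vec_add_def)

lemma length_vec_add [simp]: "length (vec_add x y) = min (length x) (length y)"
  by (simp add: vec_add_def)

lemma vec_add_in_F2_vec: "x \<in> F2_vec n \<Longrightarrow> y \<in> F2_vec n \<Longrightarrow> vec_add x y \<in> F2_vec n"
  by (simp add: F2_vec_def)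

lemma bit_add_self_left: "a + (a + b) = (b :: bit)"
  by (cases a; cases b) simp_all

lemma vec_add_cancel:
  "length x = length y \<Longrightarrow> vec_add x (vec_add x y) = y"
  by (rule nth_equalityI) (simp_all add: vec_add_nth bit_add_self_left)

text \<open>The noise taking \<open>x\<close> to \<open>y\<close> is their sum, and
  \<open>chi_add\<close> turns it into the product occurring in \<open>tilt\<close>.\<close>

lemma pmf_replicate_noise_tilt:
  assumes "0 \<le> p" "p \<le> 1" "x \<in> F2_vec n" "y \<in> F2_vec n"
  shows "pmf (replicate_pmf n (map_pmf of_bool (bernoulli_pmf p))) (vec_add x y) =
    tilt (1 - 2 * p) x y / 2 ^ n"
  using assms pmf_replicate_bernoulli[OF assms(1,2), of "vec_add x y"]
  by (simp add: F2_vec_def tilt_def vec_add_nth chi_add prod_dividef mult.assoc)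

text \<open>Serves to condition on the input \<open>x\<close>: then \<open>f x\<close> is a constant
  \<open>c\<close>, and only the output is still random.\<close>

lemma pmf_map_Pair:
  "pmf (map_pmf (\<lambda>z. (c, g z)) N) (b, y) = (if c = b then pmf (map_pmf g N) y else 0)"
proof -
  have eq: "map_pmf (\<lambda>z. (c, g z)) N = map_pmf (Pair c) (map_pmf g N)"
    by (simp add: pmf.map_comp o_def)
  show ?thesis
  proof (cases "c = b")
    case True
    then show ?thesis
      unfolding eq using pmf_map_inj'[of "Pair c" "map_pmf g N" y] by (simp add: inj_on_def)
  next
    case False
    then show ?thesis
      by (auto intro!: pmf_map_outside)
  qed
qed

lemma tilt_commute: "x \<in> F2_vec n \<Longrightarrow> y \<in> F2_vec n \<Longrightarrow> tilt d x y = tilt d y x"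
  by (simp add: tilt_def F2_vec_def mult_ac)

lemma pmf_channel_output:
  assumes "0 < p" "p \<le> 1 / 2" "x \<in> F2_vec n" "y \<in> F2_vec n"
  shows "pmf (map_pmf (vec_add x) (replicate_pmf n (map_pmf of_bool (bernoulli_pmf p)))) y =
    tilt (1 - 2 * p) x y / 2 ^ n"
proof -
  let ?N = "replicate_pmf n (map_pmf of_bool (bernoulli_pmf p)) :: bit list pmf"
  have pmf: "pmf ?N (vec_add x y) = tilt (1 - 2 * p) x y / 2 ^ n"
    using assms by (intro pmf_replicate_noise_tilt) auto
  \<comment> \<open>Positivity places the noise word in the support, where \<open>vec_add x\<close>
    is injective; on arbitrary lists it truncates.\<close>
  moreover have "tilt (1 - 2 * p) x y > 0"
    using assms by (intro tilt_pos) auto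
  ultimately have "vec_add x y \<in> set_pmf ?N"
    by (simp add: set_pmf_iff)
  moreover have "inj_on (vec_add x) (set_pmf ?N)"
    using assms(3) by (intro inj_on_inverseI[where g = "vec_add x"])
      (auto simp: set_replicate_pmf F2_vec_def intro!: vec_add_cancel)
  ultimately have "pmf (map_pmf (vec_add x) ?N) (vec_add x (vec_add x y)) = pmf ?N (vec_add x y)"
    by (intro pmf_map_inj)
  then show ?thesis
    using assms(3,4) by (simp add: vec_add_cancel F2_vec_def pmf)
qed

definition fibre :: "nat \<Rightarrow> (bit list \<Rightarrow> bit list) \<Rightarrow> bit list \<Rightarrow> bit list set" where
  "fibre n f b = {x \<in> F2_vec n. f x = b}"

lemma finite_fibre [simp]: "finite (fibre n f b)"
  by (simp add: fibre_def)

lemma F2_vec_nonempty [simp]: "F2_vec n \<noteq> {}"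
  using card_F2_vec[of n] by auto

lemma sum_fibre_weight: "(\<Sum>b\<in>f ` F2_vec n. card (fibre n f b) / 2 ^ n :: real) = 1"
proof -
  have "(\<Sum>b\<in>f ` F2_vec n. card (fibre n f b)) = 2 ^ n"
    using sum.image_gen[of "F2_vec n" "\<lambda>_. 1 :: nat" f] by (simp add: card_F2_vec fibre_def)
  then have "(\<Sum>b\<in>f ` F2_vec n. real (card (fibre n f b))) = 2 ^ n"
    unfolding of_nat_sum[symmetric] by simp
  then show ?thesis by (simp add: sum_divide_distrib[symmetric])
qed

text \<open>As \<open>Y\<close> is uniform, the mutual information is the average, over the values
  of \<open>f\<close>, of the divergence from uniform of the output law given that value.\<close>

lemma MI_bsc_eq:
  fixes f :: "bit list \<Rightarrow> bit list" and n :: nat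
  assumes p: "0 < p" "p \<le> 1 / 2"
  defines "q \<equiv> \<lambda>b. fibre_density (1 - 2 * p) (fibre n f b)"
  shows "MI_bsc n p f = (\<Sum>b\<in>f ` F2_vec n. card (fibre n f b) / 2 ^ n *
    ((\<Sum>y\<in>F2_vec n. q b y * log 2 (q b y)) / 2 ^ n))"
proof -
  let ?V = "F2_vec n"
  let ?D = "input_noise n p"
  let ?N = "replicate_pmf n (map_pmf of_bool (bernoulli_pmf p)) :: bit list pmf"
  define X where "X = (\<lambda>(x, z::bit list). f x)"
  define Y where "Y = (\<lambda>(x, z). vec_add x z)"
  have XY: "map_pmf (\<lambda>\<omega>. (X \<omega>, Y \<omega>)) ?D =
      bind_pmf (pmf_of_set ?V) (\<lambda>x. map_pmf (\<lambda>z. (f x, vec_add x z)) ?N)"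
    by (simp add: input_noise_def pair_pmf_def X_def Y_def map_bind_pmf map_pmf_def
        bind_assoc_pmf bind_return_pmf)
  have X: "map_pmf X ?D = bind_pmf (pmf_of_set ?V) (\<lambda>x. return_pmf (f x))"
    by (simp add: input_noise_def pair_pmf_def X_def map_bind_pmf map_pmf_def
        bind_assoc_pmf bind_return_pmf)
  have Y: "map_pmf Y ?D = bind_pmf (pmf_of_set ?V) (\<lambda>x. map_pmf (vec_add x) ?N)"
    by (simp add: input_noise_def pair_pmf_def Y_def map_bind_pmf map_pmf_def
        bind_assoc_pmf bind_return_pmf)
  have card_pos: "card (fibre n f b) > 0" if "b \<in> f ` ?V" for b
    using that by (auto simp: card_gt_0_iff fibre_def)
  have pmf_XY: "pmf (map_pmf (\<lambda>\<omega>. (X \<omega>, Y \<omega>)) ?D) (b, y) = card (fibre n f b) / 2 ^ n * (q b y / 2 ^ n)"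
    if b: "b \<in> f ` ?V" and y: "y \<in> ?V" for b y
  proof -
    have "pmf (map_pmf (\<lambda>\<omega>. (X \<omega>, Y \<omega>)) ?D) (b, y) =
        (\<Sum>x\<in>?V. if f x = b then tilt (1 - 2 * p) x y / 2 ^ n else 0) / 2 ^ n"
      unfolding XY by (subst pmf_bind_pmf_of_set)
        (auto simp: pmf_map_Pair card_F2_vec pmf_channel_output[OF p _ y] intro!: sum.cong)
    also have "(\<Sum>x\<in>?V. if f x = b then tilt (1 - 2 * p) x y / 2 ^ n else 0) =
        (\<Sum>x\<in>fibre n f b. tilt (1 - 2 * p) x y) / 2 ^ n"
      unfolding fibre_def sum_divide_distrib by (rule sum.inter_filter[symmetric]) simp
    finally show ?thesis
      using card_pos[OF b] by (simp add: q_def fibre_density_def)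
  qed
  have pmf_X: "pmf (map_pmf X ?D) b = card (fibre n f b) / 2 ^ n" for b
  proof -
    have pmf_return_eq: "pmf (return_pmf (f x)) b = (if f x = b then 1 else 0)" for x
      by (simp add: indicator_def)
    have "pmf (map_pmf X ?D) b = (\<Sum>x\<in>?V. if f x = b then 1 else 0) / 2 ^ n"
      unfolding X by (subst pmf_bind_pmf_of_set)
        (simp_all only: pmf_return_eq card_F2_vec finite_F2_vec F2_vec_nonempty of_nat_power
          of_nat_numeral not_False_eq_True)
    also have "(\<Sum>x\<in>?V. if f x = b then 1 else 0) = real (card (fibre n f b))"
      unfolding fibre_def by (subst sum.inter_filter[symmetric]) simp_all
    finally show ?thesis .
  qed
  \<comment> \<open>By symmetry of \<open>tilt\<close>, the sum over inputs is evaluated like a sum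
    over outputs.\<close>
  have pmf_Y: "pmf (map_pmf Y ?D) y = 1 / 2 ^ n" if y: "y \<in> ?V" for y
  proof -
    have "pmf (map_pmf Y ?D) y = (\<Sum>x\<in>?V. tilt (1 - 2 * p) y x / 2 ^ n) / 2 ^ n"
      unfolding Y using y by (subst pmf_bind_pmf_of_set)
        (auto simp: card_F2_vec pmf_channel_output[OF p _ y] tilt_commute[OF y] intro!: sum.cong)
    then show ?thesis
      using y by (simp add: sum_divide_distrib[symmetric] sum_tilt)
  qed
  have supp: "set_pmf (map_pmf (\<lambda>\<omega>. (X \<omega>, Y \<omega>)) ?D) \<subseteq> f ` ?V \<times> ?V"
  proof -
    have "set_pmf (pmf_of_set ?V) = ?V" by (rule set_pmf_of_set) simp_all
    moreover have "set_pmf ?N \<subseteq> ?V" by (auto simp: set_replicate_pmf F2_vec_def)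
    ultimately show ?thesis
      unfolding XY by (auto intro!: vec_add_in_F2_vec)
  qed
  have "MI_bsc n p f = (\<Sum>(b, y)\<in>f ` ?V \<times> ?V.
      card (fibre n f b) / 2 ^ n * (q b y / 2 ^ n) *
      log 2 (card (fibre n f b) / 2 ^ n * (q b y / 2 ^ n) /
        (card (fibre n f b) / 2 ^ n * (1 / 2 ^ n))))"
    unfolding MI_bsc_def X_def[symmetric] Y_def[symmetric]
    by (subst mutual_information_pmf[OF _ countable_UNIV_bit_list countable_UNIV_bit_list _ supp])
      (auto intro!: sum.cong simp: pmf_XY pmf_X pmf_Y)
  \<comment> \<open>The positive fibre weight and the factor \<open>1 / 2 ^ n\<close> cancel inside
    the logarithm.\<close>
  also have "\<dots> = (\<Sum>(b, y)\<in>f ` ?V \<times> ?V.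
      card (fibre n f b) / 2 ^ n * (q b y * log 2 (q b y) / 2 ^ n))"
    using card_pos by (intro sum.cong refl) (fastforce simp: case_prod_unfold)
  also have "\<dots> = (\<Sum>b\<in>f ` ?V. card (fibre n f b) / 2 ^ n *
      ((\<Sum>y\<in>?V. q b y * log 2 (q b y)) / 2 ^ n))"
    by (simp add: sum.cartesian_product[symmetric] sum_distrib_left sum_divide_distrib)
  finally show ?thesis .
qed

text \<open>The expected squared norm of the conditional mean of the +1/-1 input vector given the
  value of \<open>f\<close>.\<close>

definition mean_square_centroid :: "nat \<Rightarrow> (bit list \<Rightarrow> bit list) \<Rightarrow> real" where
  "mean_square_centroid n f =
    (\<Sum>b\<in>f ` F2_vec n. card (fibre n f b) / 2 ^ n * (\<Sum>i<n. (centroid (fibre n f b) i)\<^sup>2))"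

text \<open>Averages the divergence bound over the fibres. The weights have total 1, so the error
  term is unchanged; the factor \<open>ln 2\<close> converts bits to nats.\<close>

lemma MI_bsc_ge:
  fixes f :: "bit list \<Rightarrow> bit list" and n :: nat
  assumes p: "0 < p" "p \<le> 1 / 2"
  shows "MI_bsc n p f * ln 2 \<ge>
    (1 - 2 * p)\<^sup>2 / 2 * mean_square_centroid n f - (2 ^ n * (1 - 2 * p)) ^ 3 / 6"
proof -
  let ?d = "1 - 2 * p"
  let ?K = "(2 ^ n * ?d) ^ 3 / 6"
  let ?w = "\<lambda>b. card (fibre n f b) / 2 ^ n :: real"
  let ?q = "\<lambda>b. fibre_density ?d (fibre n f b)"
  let ?m = "\<lambda>b. \<Sum>i<n. (centroid (fibre n f b) i)\<^sup>2"
  have split: "A * (\<Sum>b\<in>B. w b * m b) - K * (\<Sum>b\<in>B. w b) = (\<Sum>b\<in>B. w b * (A * m b - K))"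
    for A K :: real and B :: "bit list set" and w m
    by (simp add: right_diff_distrib sum_subtractf sum_distrib_left mult_ac)
  have "?d\<^sup>2 / 2 * mean_square_centroid n f - ?K =
      ?d\<^sup>2 / 2 * mean_square_centroid n f - ?K * (\<Sum>b\<in>f ` F2_vec n. ?w b)"
    by (simp only: sum_fibre_weight mult_1_right)
  also have "\<dots> = (\<Sum>b\<in>f ` F2_vec n. ?w b * (?d\<^sup>2 / 2 * ?m b - ?K))"
    unfolding mean_square_centroid_def by (rule split)
  also have "\<dots> \<le> (\<Sum>b\<in>f ` F2_vec n. ?w b * ((\<Sum>y\<in>F2_vec n. ?q b y * ln (?q b y)) / 2 ^ n))"
  proof (intro sum_mono mult_left_mono)
    fix b assume "b \<in> f ` F2_vec n"
    then have "2 ^ n * (?d\<^sup>2 / 2 * ?m b - ?K) \<le> (\<Sum>y\<in>F2_vec n. ?q b y * ln (?q b y))"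
      using p by (intro fibre_divergence_ge) (auto simp: fibre_def)
    then show "?d\<^sup>2 / 2 * ?m b - ?K \<le> (\<Sum>y\<in>F2_vec n. ?q b y * ln (?q b y)) / 2 ^ n"
      by (simp add: pos_le_divide_eq mult.commute)
  qed simp
  also have "\<dots> = MI_bsc n p f * ln 2"
    unfolding MI_bsc_eq[OF p] sum_distrib_right
    by (intro sum.cong refl) (simp add: log_def sum_divide_distrib[symmetric])
  finally show ?thesis .
qed

section \<open>Comparison with the capacity near noise level 1/2\<close>

lemma bsc_capacity_eq:
  assumes "0 < p" "p < 1"
  shows "bsc_capacity p * ln 2 = p * ln (2 * p) + (1 - p) * ln (2 * (1 - p))"
proof -
  have "ln (2 * p) = ln 2 + ln p" "ln (2 * (1 - p)) = ln 2 + ln (1 - p)"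
    using assms by (intro ln_mult_pos; simp)+
  then show ?thesis
    by (simp only: bsc_capacity_def h2_def log_def) (simp add: field_simps)
qed

text \<open>With \<open>d = 1 - 2 * p\<close>, the numerator is
  \<open>((1 + d) * ln (1 + d) + (1 - d) * ln (1 - d)) / 2\<close>, whose expansion starts with
  \<open>d ^ 2 / 2\<close>.\<close>

lemma bsc_capacity_asymp:
  "((\<lambda>p. bsc_capacity p * ln 2 / (1 - 2 * p)\<^sup>2) \<longlongrightarrow> 1 / 2) (at_left (1 / 2))"
proof (rule Lim_transform_eventually)
  show "((\<lambda>p::real. (p * ln (2 * p) + (1 - p) * ln (2 * (1 - p))) / (1 - 2 * p)\<^sup>2) \<longlongrightarrow> 1 / 2)
      (at_left (1 / 2))"
    by real_asymp
  have "eventually (\<lambda>p::real. p \<in> {0<..<1 / 2}) (at_left (1 / 2))"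
    by (rule eventually_at_leftI[of 0]) auto
  then show "eventually (\<lambda>p. (p * ln (2 * p) + (1 - p) * ln (2 * (1 - p))) / (1 - 2 * p)\<^sup>2 =
      bsc_capacity p * ln 2 / (1 - 2 * p)\<^sup>2) (at_left (1 / 2))"
    by eventually_elim (simp add: bsc_capacity_eq)
qed

text \<open>After division by \<open>(1 - 2 * p) ^ 2\<close>, the lower bound on the information
  minus \<open>k\<close> times the capacity, in nats, tends to half of
  \<open>mean_square_centroid n f - k\<close>, which is positive.\<close>

theorem MI_bsc_gt_capacity:
  assumes "real k < mean_square_centroid n f"
  shows "\<exists>\<epsilon>>0. \<forall>p\<in>{1/2 - \<epsilon> <..< 1/2}. MI_bsc n p f > real k * bsc_capacity p"
proof -
  let ?M = "mean_square_centroid n f"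
  have "((\<lambda>p. ?M / 2 - (2 ^ n) ^ 3 / 6 * (1 - 2 * p) -
      real k * (bsc_capacity p * ln 2 / (1 - 2 * p)\<^sup>2)) \<longlongrightarrow>
      ?M / 2 - (2 ^ n) ^ 3 / 6 * (1 - 2 * (1 / 2)) - real k * (1 / 2)) (at_left (1 / 2 :: real))"
    by (intro tendsto_intros bsc_capacity_asymp)
  then have "eventually (\<lambda>p. 0 < ?M / 2 - (2 ^ n) ^ 3 / 6 * (1 - 2 * p) -
      real k * (bsc_capacity p * ln 2 / (1 - 2 * p)\<^sup>2)) (at_left (1 / 2 :: real))"
    using assms by (intro order_tendstoD) auto
  then obtain a where a: "a < 1 / 2" and gap: "\<And>p. a < p \<Longrightarrow> p < 1 / 2 \<Longrightarrow>
      0 < ?M / 2 - (2 ^ n) ^ 3 / 6 * (1 - 2 * p) - real k * (bsc_capacity p * ln 2 / (1 - 2 * p)\<^sup>2)"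
    by (auto simp: eventually_at_left_field)
  \<comment> \<open>The cap at 1/2 keeps \<open>p\<close> positive.\<close>
  define \<epsilon> where "\<epsilon> = min (1 / 2) (1 / 2 - a)"
  have "MI_bsc n p f > real k * bsc_capacity p" if "p \<in> {1/2 - \<epsilon> <..< 1/2}" for p
  proof -
    define d where "d = 1 - 2 * p"
    have p: "a < p" "0 < p" "p < 1 / 2" using that by (auto simp: \<epsilon>_def)
    then have "d \<noteq> 0" by (simp add: d_def)
    then have d: "d\<^sup>2 > 0" by simp
    have "0 < d\<^sup>2 * (?M / 2 - (2 ^ n) ^ 3 / 6 * d - real k * (bsc_capacity p * ln 2 / d\<^sup>2))"
      using gap[OF p(1,3)] d unfolding d_def[symmetric] by (rule mult_pos_pos[rotated])
    also have "\<dots> = d\<^sup>2 / 2 * ?M - (2 ^ n * d) ^ 3 / 6 - real k * bsc_capacity p * ln 2"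
      using \<open>d \<noteq> 0\<close> by (simp add: field_simps power2_eq_square power3_eq_cube)
    also have "\<dots> \<le> (MI_bsc n p f - real k * bsc_capacity p) * ln 2"
      using MI_bsc_ge[of p n f] p by (simp add: d_def algebra_simps)
    finally show ?thesis by (simp add: zero_less_mult_iff)
  qed
  moreover have "\<epsilon> > 0" using a by (simp add: \<epsilon>_def)
  ultimately show ?thesis by blast
qed

section \<open>A quantizer from a [12,8] code\<close>

text \<open>The check matrix has the columns 1, 2, 4, 8, 11, 13, 14, 7, 9, 10, 12, 15 (in binary). The
  nonzero syndromes 3, 5, 6 are missing, and each of them is 8 plus another column; hence all
  three leaders of weight two can share the coordinate with index 3. This uneven use of the
  coordinates matters: three disjoint leaders would give \<open>k - 1 / 32\<close> as mean squared centroid.\<close>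

definition parity :: "bit list \<Rightarrow> bit list" where
  "parity b =
    [b ! 0 + b ! 1 + b ! 3 + b ! 4 + b ! 7,
     b ! 0 + b ! 2 + b ! 3 + b ! 5 + b ! 7,
     b ! 1 + b ! 2 + b ! 3 + b ! 6 + b ! 7,
     b ! 0 + b ! 1 + b ! 2 + b ! 4 + b ! 5 + b ! 6 + b ! 7]"

text \<open>With the check bits in front, \<open>drop 4\<close> reads off the message at every
  length; message bits from index 8 on are not seen by \<open>parity\<close> and stay
  uncoded.\<close>

definition encode :: "bit list \<Rightarrow> bit list" where
  "encode b = parity b @ b"

text \<open>The check matrix in systematic form: the leading four bits plus the recomputed check
  bits.\<close>

definition syndrome :: "bit list \<Rightarrow> bit list" where
  "syndrome x = vec_add (take 4 x) (parity (drop 4 x))"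

definition indicator_vec :: "nat \<Rightarrow> nat list \<Rightarrow> bit list" where
  "indicator_vec n T = map (\<lambda>i. of_bool (i \<in> set T)) [0..<n]"

text \<open>One support per syndrome: zero, the twelve unit vectors, and the pairs with syndromes
  8+11=3, 8+13=5 and 8+14=6 (bitwise sums).\<close>

definition supports :: "nat list list" where
  "supports = [[], [0], [1], [2], [3], [4], [5], [6], [7], [8], [9], [10], [11],
    [3, 4], [3, 5], [3, 6]]"

definition leader :: "nat \<Rightarrow> bit list \<Rightarrow> bit list" where
  "leader n s = indicator_vec n (SOME T. T \<in> set supports \<and> syndrome (indicator_vec n T) = s)"

text \<open>Syndrome decoding: adding the coset leader gives a codeword, whose message part is
  returned.\<close>

definition quantizer :: "bit list \<Rightarrow> bit list" where
  "quantizer x = drop 4 (vec_add x (leader (length x) (syndrome x)))"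

lemma length_indicator_vec [simp]: "length (indicator_vec n T) = n"
  by (simp add: indicator_vec_def)

lemma indicator_vec_nth: "i < n \<Longrightarrow> indicator_vec n T ! i = of_bool (i \<in> set T)"
  by (simp add: indicator_vec_def)

lemma length_parity [simp]: "length (parity b) = 4"
  by (simp add: parity_def)

lemma length_encode [simp]: "length (encode b) = length b + 4"
  by (simp add: encode_def)

lemma length_syndrome: "length x \<ge> 4 \<Longrightarrow> length (syndrome x) = 4"
  by (simp add: syndrome_def)

section \<open>Linearity of the syndrome map\<close>

lemma vec_add_commute: "vec_add x y = vec_add y x"
  by (rule nth_equalityI) (simp_all add: vec_add_def add.commute)

lemma vec_add_assoc: "vec_add (vec_add x y) z = vec_add x (vec_add y z)"
  by (rule nth_equalityI) (simp_all add: vec_add_def add.assoc)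

lemma vec_add_left_commute: "vec_add x (vec_add y z) = vec_add y (vec_add x z)"
  by (metis vec_add_assoc vec_add_commute)

lemma parity_vec_add:
  assumes "length x = length y" "length x \<ge> 8"
  shows "parity (vec_add x y) = vec_add (parity x) (parity y)"
proof -
  have "vec_add x y ! i = x ! i + y ! i" if "i < 8" for i
    using assms that by (intro vec_add_nth) auto
  then show ?thesis
    by (simp add: parity_def) (simp add: vec_add_def add_ac)
qed

lemma syndrome_vec_add:
  assumes "length x = length y" "length x \<ge> 12"
  shows "syndrome (vec_add x y) = vec_add (syndrome x) (syndrome y)"
proof -
  have "take 4 (vec_add x y) = vec_add (take 4 x) (take 4 y)"
    "drop 4 (vec_add x y) = vec_add (drop 4 x) (drop 4 y)"
    by (simp_all add: vec_add_def take_map drop_map take_zip drop_zip)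
  then show ?thesis
    using assms by (simp add: syndrome_def parity_vec_add vec_add_assoc vec_add_commute vec_add_left_commute)
qed

lemma bit_add_self: "a + a = (0 :: bit)"
  by (cases a) simp_all

lemma vec_add_self: "vec_add x x = replicate (length x) 0"
  by (rule nth_equalityI) (simp_all add: vec_add_nth bit_add_self)

lemma vec_add_zero: "vec_add (replicate (length x) 0) x = x"
  by (rule nth_equalityI) (simp_all add: vec_add_nth)

lemma syndrome_encode: "syndrome (encode b) = replicate 4 0"
  using vec_add_self[of "parity b"] by (simp add: syndrome_def encode_def)

text \<open>Zero syndrome forces the first four bits to equal the recomputed check bits.\<close>

lemma encode_drop:
  assumes "length x \<ge> 4" "syndrome x = replicate 4 0"
  shows "encode (drop 4 x) = x"
proof -
  have "take 4 x = parity (drop 4 x)"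
  proof -
    have "parity (drop 4 x) = vec_add (take 4 x) (vec_add (take 4 x) (parity (drop 4 x)))"
      using assms(1) by (simp add: vec_add_cancel)
    also have "\<dots> = vec_add (replicate 4 0) (take 4 x)"
      using assms(2) by (simp add: syndrome_def vec_add_commute)
    also have "\<dots> = take 4 x"
      using vec_add_zero[of "take 4 x"] assms(1) by simp
    finally show ?thesis by simp
  qed
  then show ?thesis by (metis append_take_drop_id encode_def)
qed

section \<open>Coset leaders and the fibres of the quantizer\<close>

lemma distinct_supports: "distinct supports"
  by (simp add: supports_def)

lemma syndromes_of_supports:
  assumes "n \<ge> 12"
  shows "map (\<lambda>T. syndrome (indicator_vec n T)) supports =
    [[0,0,0,0], [1,0,0,0], [0,1,0,0], [0,0,1,0], [0,0,0,1],
     [1,1,0,1], [1,0,1,1], [0,1,1,1], [1,1,1,0], [1,0,0,1], [0,1,0,1], [0,0,1,1], [1,1,1,1],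
     [1,1,0,0], [1,0,1,0], [0,1,1,0]]"
proof -
  \<comment> \<open>Message bit \<open>j\<close> sits at index \<open>j + 4\<close>; the formula
    reduces all sixteen cases to deciding membership of numerals.\<close>
  have "syndrome (indicator_vec n T) =
    [of_bool (0 \<in> set T) + (of_bool (4 \<in> set T) + of_bool (5 \<in> set T) + of_bool (7 \<in> set T) +
       of_bool (8 \<in> set T) + of_bool (11 \<in> set T)),
     of_bool (1 \<in> set T) + (of_bool (4 \<in> set T) + of_bool (6 \<in> set T) + of_bool (7 \<in> set T) +
       of_bool (9 \<in> set T) + of_bool (11 \<in> set T)),
     of_bool (2 \<in> set T) + (of_bool (5 \<in> set T) + of_bool (6 \<in> set T) + of_bool (7 \<in> set T) +
       of_bool (10 \<in> set T) + of_bool (11 \<in> set T)),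
     of_bool (3 \<in> set T) + (of_bool (4 \<in> set T) + of_bool (5 \<in> set T) + of_bool (6 \<in> set T) +
       of_bool (8 \<in> set T) + of_bool (9 \<in> set T) + of_bool (10 \<in> set T) + of_bool (11 \<in> set T))]" for T
  proof -
    have "take 4 (indicator_vec n T) = map (\<lambda>i. of_bool (i \<in> set T)) [0, 1, 2, 3]"
      using assms by (simp add: indicator_vec_def take_map upt_rec)
        (simp add: numeral_2_eq_2 numeral_3_eq_3)
    then show ?thesis
      using assms by (simp add: syndrome_def parity_def indicator_vec_nth vec_add_def)
  qed
  then show ?thesis by (simp add: supports_def)
qed

text \<open>Sixteen distinct syndromes in a space of size \<open>2 ^ 4\<close>: surjectivity follows
  by counting.\<close>

lemma bij_betw_syndrome:
  assumes "n \<ge> 12"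
  shows "bij_betw (\<lambda>T. syndrome (indicator_vec n T)) (set supports) (F2_vec 4)"
proof -
  let ?s = "\<lambda>T. syndrome (indicator_vec n T)"
  have "distinct (map ?s supports)"
    unfolding syndromes_of_supports[OF assms] by simp
  then have inj: "inj_on ?s (set supports)"
    by (simp add: distinct_map)
  have "card (?s ` set supports) = card (set supports)"
    using inj by (rule card_image)
  also have "\<dots> = card (F2_vec 4)"
    using distinct_card[OF distinct_supports] by (simp add: card_F2_vec supports_def)
  finally have "?s ` set supports = F2_vec 4"
    using assms by (intro card_subset_eq finite_F2_vec) (auto simp: F2_vec_def length_syndrome)
  with inj show ?thesis by (simp add: bij_betw_def)
qed

lemma leader_syndrome:
  assumes "n \<ge> 12" "T \<in> set supports"
  shows "leader n (syndrome (indicator_vec n T)) = indicator_vec n T"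
proof -
  have "(SOME T'. T' \<in> set supports \<and> syndrome (indicator_vec n T') = syndrome (indicator_vec n T)) = T"
    using assms bij_betw_syndrome[OF assms(1)]
    by (intro some_equality) (auto simp: bij_betw_def dest: inj_onD)
  then show ?thesis by (simp add: leader_def)
qed

text \<open>Each fibre is the set of leaders translated by a codeword, since a codeword leaves the
  syndrome of its error unchanged.\<close>

lemma fibre_quantizer:
  assumes k: "k \<ge> 8" and b: "b \<in> F2_vec k"
  defines "t \<equiv> \<lambda>T. vec_add (encode b) (indicator_vec (k + 4) T)"
  shows "fibre (k + 4) quantizer b = t ` set supports" "inj_on t (set supports)"
proof -
  let ?n = "k + 4"
  have len: "length b = k"
    using b by (simp add: F2_vec_def)
  show "fibre ?n quantizer b = t ` set supports"
  proof (intro equalityI subsetI)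
    fix x assume "x \<in> fibre ?n quantizer b"
    then have x: "length x = ?n" "quantizer x = b"
      by (auto simp: fibre_def F2_vec_def)
    have "syndrome x \<in> F2_vec 4"
      using x by (simp add: F2_vec_def length_syndrome)
    also have "F2_vec 4 = (\<lambda>T. syndrome (indicator_vec ?n T)) ` set supports"
      using bij_betw_imp_surj_on[OF bij_betw_syndrome[of ?n]] k by simp
    finally obtain T where T: "T \<in> set supports" "syndrome (indicator_vec ?n T) = syndrome x"
      by force
    \<comment> \<open>Removing the leader with the syndrome of \<open>x\<close> leaves a
      codeword.\<close>
    define c where "c = vec_add x (indicator_vec ?n T)"
    have "syndrome c = replicate 4 0"
      using x k T(2) vec_add_self[of "syndrome x"]
      by (simp add: c_def syndrome_vec_add length_syndrome)
    then have "encode (drop 4 c) = c"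
      using x by (intro encode_drop) (simp_all add: c_def)
    moreover have "drop 4 c = b"
      using x k leader_syndrome[of ?n T] T by (simp add: quantizer_def c_def)
    ultimately have "t T = vec_add c (indicator_vec ?n T)"
      by (simp add: t_def)
    also have "\<dots> = x"
      using x vec_add_cancel[of "indicator_vec ?n T" x] by (simp add: c_def vec_add_commute)
    finally show "x \<in> t ` set supports"
      using T(1) by auto
  next
    fix x assume "x \<in> t ` set supports"
    then obtain T where T: "T \<in> set supports" and x: "x = t T" by auto
    have lx: "length x = ?n" by (simp add: x t_def len)
    have "syndrome x = syndrome (indicator_vec ?n T)"
      using k len vec_add_zero[of "syndrome (indicator_vec ?n T)"]
      by (simp add: x t_def syndrome_vec_add syndrome_encode length_syndrome)
    then have "quantizer x = drop 4 (vec_add x (indicator_vec ?n T))"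
      using k T by (simp add: quantizer_def lx leader_syndrome)
    also have "vec_add x (indicator_vec ?n T) = encode b"
      using len vec_add_cancel[of "indicator_vec ?n T" "encode b"]
      by (simp add: x t_def vec_add_commute)
    finally show "x \<in> fibre ?n quantizer b"
      using lx by (simp add: fibre_def F2_vec_def encode_def)
  qed
  show "inj_on t (set supports)"
  proof (rule inj_onI)
    fix T T' assume T: "T \<in> set supports" "T' \<in> set supports" "t T = t T'"
    have "vec_add (encode b) (t T) = vec_add (encode b) (t T')" using T by simp
    then have "indicator_vec ?n T = indicator_vec ?n T'"
      using len by (simp add: t_def vec_add_cancel)
    then show "T = T'"
      using T(1,2) k by (intro inj_onD[OF bij_betw_imp_inj_on[OF bij_betw_syndrome[of ?n]]]) simp_all
  qed
qed

lemma quantizer_image: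
  assumes "k \<ge> 8"
  shows "quantizer ` F2_vec (k + 4) = F2_vec k"
proof (intro equalityI subsetI)
  fix b assume "b \<in> quantizer ` F2_vec (k + 4)"
  then show "b \<in> F2_vec k"
    by (auto simp: F2_vec_def quantizer_def leader_def)
next
  fix b assume "b \<in> F2_vec k"
  then have "fibre (k + 4) quantizer b \<noteq> {}"
    using fibre_quantizer(1)[OF assms] by (simp add: supports_def)
  then show "b \<in> quantizer ` F2_vec (k + 4)"
    by (auto simp: fibre_def)
qed

text \<open>Sixteen times the \<open>i\<close>-th centroid coordinate of the set of leaders.\<close>

definition sign_sum :: "nat \<Rightarrow> real" where
  "sign_sum i = (\<Sum>T\<leftarrow>supports. if i \<in> set T then -1 else 1)"

lemma sum_sign_sum_squared:
  assumes "k \<ge> 8"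
  shows "(\<Sum>i<k + 4. (sign_sum i)\<^sup>2) = 256 * real k + 16"
proof -
  \<comment> \<open>An index lying in \<open>m\<close> supports has sign sum
    \<open>16 - 2 * m\<close>: 8 at index 3, 12 at indices 4, 5, 6, and 14 at the other eight, so 64
    + 3 * 144 + 8 * 196.\<close>
  have head: "(\<Sum>i<12. (sign_sum i)\<^sup>2) = 2064"
    by (simp add: sign_sum_def supports_def lessThan_nat_numeral lessThan_Suc)
  have "sign_sum i = 16" if "i \<ge> 12" for i
    using that by (simp add: sign_sum_def supports_def)
  then have tail: "(\<Sum>i\<in>{12..<k + 4}. (sign_sum i)\<^sup>2) = 256 * (real k - 8)"
    using assms by (simp add: of_nat_diff)
  have "{..<k + 4} = {..<12} \<union> {12..<k + 4}"
    using assms by auto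
  then have "(\<Sum>i<k + 4. (sign_sum i)\<^sup>2) =
      (\<Sum>i<12. (sign_sum i)\<^sup>2) + (\<Sum>i\<in>{12..<k + 4}. (sign_sum i)\<^sup>2)"
    by (simp add: sum.union_disjoint ivl_disj_int)
  then show ?thesis
    unfolding head tail by simp
qed

text \<open>Translation by a codeword only multiplies each centroid coordinate by a sign, which
  squaring removes; all fibres thus have the same squared norm.\<close>

lemma centroid_fibre_quantizer:
  assumes "k \<ge> 8" "b \<in> F2_vec k" "i < k + 4"
  shows "(centroid (fibre (k + 4) quantizer b) i)\<^sup>2 = (sign_sum i)\<^sup>2 / 256"
proof -
  let ?t = "\<lambda>T. vec_add (encode b) (indicator_vec (k + 4) T)"
  note fib = fibre_quantizer[OF assms(1,2)]
  have len: "length b = k"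
    using assms(2) by (simp add: F2_vec_def)
  have card: "card (fibre (k + 4) quantizer b) = 16"
    unfolding fib(1) using card_image[OF fib(2)] distinct_card[OF distinct_supports]
    by (simp add: supports_def)
  have "(\<Sum>x\<in>fibre (k + 4) quantizer b. chi (x ! i)) = (\<Sum>T\<in>set supports. chi (?t T ! i))"
    unfolding fib(1) by (subst sum.reindex[OF fib(2)]) simp
  also have "\<dots> = (\<Sum>T\<in>set supports. chi (encode b ! i) * (if i \<in> set T then -1 else 1))"
    using assms(3) len
    by (intro sum.cong refl) (simp add: vec_add_nth indicator_vec_nth chi_add)
  also have "\<dots> = chi (encode b ! i) * sign_sum i"
    by (simp add: sign_sum_def sum_distrib_left[symmetric]
        sum.distinct_set_conv_list[OF distinct_supports])
  finally show ?thesis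
    by (simp add: centroid_def card power_divide power_mult_distrib power2_eq_square)
qed

lemma mean_square_centroid_quantizer:
  assumes "k \<ge> 8"
  shows "mean_square_centroid (k + 4) quantizer = real k + 1 / 16"
proof -
  let ?w = "\<lambda>b. card (fibre (k + 4) quantizer b) / 2 ^ (k + 4) :: real"
  have "(\<Sum>i<k + 4. (centroid (fibre (k + 4) quantizer b) i)\<^sup>2) = real k + 1 / 16"
    if "b \<in> F2_vec k" for b
    using assms that sum_sign_sum_squared[OF assms]
    by (simp add: centroid_fibre_quantizer sum_divide_distrib[symmetric] field_simps)
  then have "mean_square_centroid (k + 4) quantizer = (\<Sum>b\<in>F2_vec k. ?w b * (real k + 1 / 16))"
    unfolding mean_square_centroid_def quantizer_image[OF assms] by (intro sum.cong) auto
  also have "\<dots> = (\<Sum>b\<in>F2_vec k. ?w b) * (real k + 1 / 16)"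
    by (simp add: sum_distrib_right)
  also have "(\<Sum>b\<in>F2_vec k. ?w b) = 1"
    using sum_fibre_weight[of "k + 4" quantizer] by (simp only: quantizer_image[OF assms])
  finally show ?thesis by simp
qed

theorem proposition12:
  fixes k :: nat
  assumes "k \<ge> 8"
  shows "\<exists>f \<in> F2_vec (k + 4) \<rightarrow> F2_vec k.
           \<exists>\<epsilon>>0. \<forall>p\<in>{1/2 - \<epsilon> <..< 1/2}. MI_bsc (k + 4) p f > real k * bsc_capacity p"
proof (rule bexI)
  show "\<exists>\<epsilon>>0. \<forall>p\<in>{1/2 - \<epsilon> <..< 1/2}. MI_bsc (k + 4) p quantizer > real k * bsc_capacity p"
    by (rule MI_bsc_gt_capacity) (simp add: mean_square_centroid_quantizer[OF assms])
  show "quantizer \<in> F2_vec (k + 4) \<rightarrow> F2_vec k"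
    using quantizer_image[OF assms] by auto
qed

end
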